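(* Let $n\geq 2$ be an integer. Then $$\mathrm{gr}\big(\mathcal{G}(\mathbb{Z}_n[x])\big)=\mathrm{gr}\big(\mathcal{G}(\mathbb{Z}_n)\big)=\begin{cases}\infty & \text{if } n=2,\\ n & \text{if } n=p^k \text{ or } n=2p^k \text{ for some odd prime } p \text{ and positive integer } k,\\ 4 & \text{otherwise}.\end{cases}$$
   Context: $\mathbb{Z}_n$ denotes the ring of integers modulo $n$. For a commutative ring $R$ with identity, the involutory Cayley graph $\mathcal{G}(R)$ is the simple undirected graph with vertex set $R$ in which two vertices $a,b$ are adjacent if and only if $(a-b)^2=1$. The girth $\mathrm{gr}(G)$ of a graph $G$ is the length of its shortest cycle, with $\mathrm{gr}(G)=\infty$ if $G$ contains no cycles. *)

theory Defs
  imports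
    "HOL-Number_Theory.Residues"
    "HOL-Library.Extended_Nat"
    "Graph_Theory.Pair_Digraph"
begin

text \<open>An undirected graph is encoded as a symmetric set of arcs. The distinctness requirement
  excludes loops; it matters only for the zero ring, in which \<open>0\<^sup>2 = 1\<close>.\<close>

definition involutory_cayley_graph :: "('a, 'm) ring_scheme \<Rightarrow> 'a pair_pre_digraph" where
  "involutory_cayley_graph R =
     \<lparr>pverts = carrier R,
      parcs = {(a, b). a \<in> carrier R \<and> b \<in> carrier R \<and> a \<noteq> b \<and>
                       (a \<ominus>\<^bsub>R\<^esub> b) [^]\<^bsub>R\<^esub> (2::nat) = \<one>\<^bsub>R\<^esub>}\<rparr>"

lemma (in cring) pair_bidirected_digraph_involutory_cayley_graph:
  "pair_bidirected_digraph (involutory_cayley_graph R)"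
proof
  have "(b \<ominus> a) [^] (2::nat) = (a \<ominus> b) [^] (2::nat)"
    if "a \<in> carrier R" "b \<in> carrier R" for a b
  proof -
    have "b \<ominus> a = \<ominus> (a \<ominus> b)"
      using that by (simp add: minus_eq minus_add a_comm)
    then show ?thesis
      using that by (simp add: numeral_2_eq_2 l_minus r_minus)
  qed
  then show "symmetric (with_proj (involutory_cayley_graph R))"
    by (auto simp: symmetric_def involutory_cayley_graph_def intro!: symI)
qed (auto simp: involutory_cayley_graph_def)

text \<open>The constant \<open>cycle\<close> of the digraph library counts the closed walk that runs along an edge
  and back as a cycle of length two. In an undirected simple graph this is not a cycle, hence the
  lower bound on the length. The infimum of the empty set in \<^typ>\<open>enat\<close> is \<open>\<infinity>\<close>.\<close>

definition girth :: "'a pair_pre_digraph \<Rightarrow> enat" where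
  "girth G = Inf {enat (length c) | c. pre_digraph.cycle (with_proj G) c \<and> 3 \<le> length c}"

end

theory Submission
  imports Defs "HOL-Algebra.UnivPoly" "HOL-Computational_Algebra.Polynomial"
begin

text \<open>
  The edges at a vertex \<open>a\<close> lead to \<open>a + u\<close> for the \<^emph>\<open>involutions\<close> \<open>u\<close>, the solutions of
  \<open>u\<^sup>2 = 1\<close>, so the girth depends on which involutions there are. Three facts hold in every
  commutative ring.

  \<^item> A triangle is a relation \<open>u + v = w\<close> between involutions; squaring gives \<open>2uv = -1\<close>, and
    squaring again gives \<open>4 = 1\<close>. So triangles exist only if \<open>3 = 0\<close>
    (\<open>triangle_imp_three_eq_zero\<close>).
  \<^item> An involution \<open>u\<close> other than \<open>1\<close> and \<open>-1\<close> yields the \<open>4\<close>-cycle \<open>0, 1, 1 + u, u\<close>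
    (\<open>vertex_cycle_4_of_involution\<close>).
  \<^item> If \<open>1\<close> and \<open>-1\<close> are the only involutions, a cycle cannot turn back and therefore repeats
    the same step all the time. Its length is then a multiple of the characteristic, and there is
    no cycle at all if \<open>1 = -1\<close> (\<open>vertex_cycle_of_trivial_involutions\<close>).

  Write \<open>R = \<int>\<^sub>n\<close> and \<open>g\<close> for the claimed value. The theorem follows from the chain
  \<open>girth R[x] \<le> girth R \<le> g \<le> girth R[x]\<close>, so that only upper bounds are needed for \<open>R\<close> and only
  lower bounds for \<open>R[x]\<close>. The first inequality holds since the constants embed \<open>R\<close> into \<open>R[x]\<close>.
  The second uses the cycle \<open>0, 1, \<dots>, n - 1\<close>, which also serves \<open>n = 4\<close>, or else the \<open>4\<close>-cycle
  coming from an involution other than \<open>1\<close> and \<open>-1\<close>, which exists whenever \<open>n\<close> is none of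
  \<open>2\<close>, \<open>4\<close>, \<open>p\<^sup>k\<close>, \<open>2p\<^sup>k\<close>. For the third, \<open>R[x]\<close> has only the involutions \<open>1\<close> and \<open>-1\<close> if
  \<open>n = 2\<close>, \<open>n = p\<^sup>k\<close> or \<open>n = 2p\<^sup>k\<close>: then \<open>n\<close> divides \<open>(F - 1)(F + 1)\<close> in \<open>\<int>[x]\<close>. There
  the odd prime \<open>p\<close> is a prime element that cannot divide both factors, while \<open>2\<close> divides both as
  soon as it divides one. In the remaining cases it is enough that \<open>R[x]\<close>
  has no triangle, as \<open>n\<close> does not divide \<open>3\<close>.
\<close>

section \<open>Cycles as closed vertex sequences\<close>

text \<open>
  A cycle is a list of arcs in the digraph library; arguments about steps are easier for the
  sequence of its vertices. The start is listed again as \<open>v L\<close>, hence injectivity on \<open>{1..L}\<close>.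
\<close>

definition vertex_cycle :: "'a pair_pre_digraph \<Rightarrow> nat \<Rightarrow> (nat \<Rightarrow> 'a) \<Rightarrow> bool" where
  "vertex_cycle G L v \<longleftrightarrow>
     v 0 = v L \<and> inj_on v {1..L} \<and> (\<forall>i<L. (v i, v (Suc i)) \<in> parcs G)"

lemma pcas_nth:
  assumes "pcas u c w"
  shows "pawalk_verts u c ! 0 = u" "pawalk_verts u c ! length c = w"
    and "\<And>i. i < length c \<Longrightarrow> c ! i = (pawalk_verts u c ! i, pawalk_verts u c ! Suc i)"
proof -
  have "pawalk_verts u c ! 0 = u \<and> pawalk_verts u c ! length c = w \<and>
    (\<forall>i<length c. c ! i = (pawalk_verts u c ! i, pawalk_verts u c ! Suc i))"
    using assms
  proof (induction c arbitrary: u)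
    case (Cons e es)
    then have IH: "pawalk_verts (snd e) es ! 0 = snd e" "pawalk_verts (snd e) es ! length es = w"
      "\<And>i. i < length es \<Longrightarrow>
         es ! i = (pawalk_verts (snd e) es ! i, pawalk_verts (snd e) es ! Suc i)"
      by auto
    from Cons.prems have "fst e = u" by simp
    then show ?case
      using IH by (auto simp: nth_Cons split: nat.splits)
  qed simp
  then show "pawalk_verts u c ! 0 = u" "pawalk_verts u c ! length c = w"
    and "\<And>i. i < length c \<Longrightarrow> c ! i = (pawalk_verts u c ! i, pawalk_verts u c ! Suc i)"
    by auto
qed

lemma arcs_of_vertices:
  assumes "j \<le> L"
  shows "pcas (v j) (map (\<lambda>i. (v i, v (Suc i))) [j..<L]) (v L)"
    and "pawalk_verts (v j) (map (\<lambda>i. (v i, v (Suc i))) [j..<L]) = map v [j..<Suc L]"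
proof -
  have "pcas (v j) (map (\<lambda>i. (v i, v (Suc i))) [j..<L]) (v L) \<and>
    pawalk_verts (v j) (map (\<lambda>i. (v i, v (Suc i))) [j..<L]) = map v [j..<Suc L]"
    using assms
  proof (induction j rule: inc_induct)
    case (step j)
    then have "[j..<L] = j # [Suc j..<L]" "[j..<Suc L] = j # [Suc j..<Suc L]"
      by (auto simp: upt_conv_Cons simp del: upt_Suc)
    then show ?case using step.IH by (simp del: upt_Suc)
  qed simp
  then show "pcas (v j) (map (\<lambda>i. (v i, v (Suc i))) [j..<L]) (v L)"
    and "pawalk_verts (v j) (map (\<lambda>i. (v i, v (Suc i))) [j..<L]) = map v [j..<Suc L]"
    by auto
qed

lemma (in pair_wf_digraph) cycle_iff_vertex_cycle:
  assumes "L > 0"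
  shows "(\<exists>c. cycle c \<and> length c = L) \<longleftrightarrow> (\<exists>v. vertex_cycle G L v)"
proof
  assume "\<exists>c. cycle c \<and> length c = L"
  then obtain c u where c: "awalk u c u" "distinct (tl (pawalk_verts u c))" and L: "length c = L"
    unfolding cycle_def by auto
  from c have cas: "pcas u c u" and arcs: "set c \<subseteq> parcs G"
    by (auto simp: awalk_def)
  let ?v = "\<lambda>i. pawalk_verts u c ! i"
  have len: "length (pawalk_verts u c) = Suc L"
    using L by (induction c arbitrary: u L) auto
  have "inj_on ?v {1..L}"
  proof (rule inj_onI)
    fix i j assume ij: "i \<in> {1..L}" "j \<in> {1..L}" "?v i = ?v j"
    then have less: "i - 1 < length (tl (pawalk_verts u c))" "j - 1 < length (tl (pawalk_verts u c))"
      using len by auto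
    then have "tl (pawalk_verts u c) ! (i - 1) = tl (pawalk_verts u c) ! (j - 1)"
      using ij by (simp only: nth_tl) simp
    then have "i - 1 = j - 1"
      using nth_eq_iff_index_eq[OF c(2) less] by simp
    then show "i = j" using ij by auto
  qed
  moreover have "(?v i, ?v (Suc i)) \<in> parcs G" if "i < L" for i
    using arcs pcas_nth(3)[OF cas, of i] that L nth_mem[of i c] by auto
  moreover have "?v 0 = ?v L"
    using pcas_nth[OF cas] L by simp
  ultimately show "\<exists>v. vertex_cycle G L v"
    unfolding vertex_cycle_def by blast
next
  assume "\<exists>v. vertex_cycle G L v"
  then obtain v where v: "v 0 = v L" "inj_on v {1..L}" "\<And>i. i < L \<Longrightarrow> (v i, v (Suc i)) \<in> parcs G"
    unfolding vertex_cycle_def by blast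
  let ?c = "map (\<lambda>i. (v i, v (Suc i))) [0..<L]"
  have "v 0 \<in> pverts G"
    using v(3)[OF assms] arc_fst_in_verts[of "(v 0, v (Suc 0))"] by simp
  moreover have "pcas (v 0) ?c (v 0)"
    using arcs_of_vertices(1)[of 0 L v] v(1) by simp
  ultimately have "awalk (v 0) ?c (v 0)"
    using v(3) by (auto simp: awalk_def)
  moreover have "tl (pawalk_verts (v 0) ?c) = map v [1..<Suc L]"
    by (simp add: arcs_of_vertices(2) map_tl[symmetric] del: upt_Suc)
  moreover have "distinct (map v [1..<Suc L])"
    using v(2) by (simp add: distinct_map atLeastLessThanSuc_atLeastAtMost del: upt_Suc)
  ultimately have "cycle ?c"
    using assms unfolding cycle_def by auto
  then show "\<exists>c. cycle c \<and> length c = L" by (intro exI[of _ ?c]) simp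
qed

lemma girth_le:
  assumes "pair_wf_digraph G" "vertex_cycle G L v" "3 \<le> L"
  shows "girth G \<le> enat L"
proof -
  interpret pair_wf_digraph G by fact
  from cycle_iff_vertex_cycle[of L] assms obtain c where "cycle c" "length c = L" by auto
  then show ?thesis
    unfolding girth_def using assms(3) by (intro Inf_lower) auto
qed

lemma le_girth:
  assumes "pair_wf_digraph G" "\<And>L v. vertex_cycle G L v \<Longrightarrow> 3 \<le> L \<Longrightarrow> g \<le> enat L"
  shows "g \<le> girth G"
  unfolding girth_def
proof (rule Inf_greatest)
  interpret pair_wf_digraph G by fact
  fix x assume "x \<in> {enat (length c) |c. cycle c \<and> 3 \<le> length c}"
  then obtain c where c: "cycle c" "3 \<le> length c" "x = enat (length c)" by auto
  then have "\<exists>v. vertex_cycle G (length c) v"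
    using cycle_iff_vertex_cycle[of "length c"] by force
  then show "g \<le> x" using assms(2) c by auto
qed

section \<open>Cycles in the involutory Cayley graph of a commutative ring\<close>

lemma parcs_involutory_cayley_graph:
  "(a, b) \<in> parcs (involutory_cayley_graph R) \<longleftrightarrow>
     a \<in> carrier R \<and> b \<in> carrier R \<and> a \<noteq> b \<and>
       (a \<ominus>\<^bsub>R\<^esub> b) [^]\<^bsub>R\<^esub> (2::nat) = \<one>\<^bsub>R\<^esub>"
  by (simp add: involutory_cayley_graph_def)

lemma pair_wf_digraph_involutory_cayley_graph:
  "pair_wf_digraph (involutory_cayley_graph R)"
  by unfold_locales (auto simp: involutory_cayley_graph_def)

text \<open>
  An injective homomorphism maps distinct vertices to distinct vertices and involutions to
  involutions, hence cycles to cycles of the same length.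
\<close>

lemma girth_le_of_embedding:
  assumes "cring R" "cring S" and h: "h \<in> ring_hom R S" and inj: "inj_on h (carrier R)"
  shows "girth (involutory_cayley_graph S) \<le> girth (involutory_cayley_graph R)"
proof (rule le_girth[OF pair_wf_digraph_involutory_cayley_graph])
  interpret R: cring R by fact
  interpret S: cring S by fact
  interpret h: ring_hom_cring R S h
    by unfold_locales (rule h)
  fix L v assume v: "vertex_cycle (involutory_cayley_graph R) L v" "3 \<le> L"
  have car: "v i \<in> carrier R" if "i \<le> L" for i
    using v that unfolding vertex_cycle_def parcs_involutory_cayley_graph
    by (metis Suc_le_eq le_neq_implies_less order_less_le_trans zero_less_numeral)
  have arc: "(h a, h b) \<in> parcs (involutory_cayley_graph S)"
    if "(a, b) \<in> parcs (involutory_cayley_graph R)" for a b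
  proof -
    from that have ab: "a \<in> carrier R" "b \<in> carrier R" "a \<noteq> b"
      "(a \<ominus>\<^bsub>R\<^esub> b) [^]\<^bsub>R\<^esub> (2::nat) = \<one>\<^bsub>R\<^esub>"
      by (auto simp: parcs_involutory_cayley_graph)
    then have "h ((a \<ominus>\<^bsub>R\<^esub> b) [^]\<^bsub>R\<^esub> (2::nat)) = \<one>\<^bsub>S\<^esub>" by simp
    moreover have "h ((a \<ominus>\<^bsub>R\<^esub> b) [^]\<^bsub>R\<^esub> (2::nat)) = (h a \<ominus>\<^bsub>S\<^esub> h b) [^]\<^bsub>S\<^esub> (2::nat)"
      using ab(1,2) by (simp add: numeral_2_eq_2 R.minus_eq S.minus_eq)
    ultimately show ?thesis
      using ab inj by (auto simp: parcs_involutory_cayley_graph inj_on_eq_iff)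
  qed
  have "vertex_cycle (involutory_cayley_graph S) L (h \<circ> v)"
    unfolding vertex_cycle_def
  proof (intro conjI)
    show "inj_on (h \<circ> v) {1..L}"
      using v(1) car by (intro comp_inj_on inj_on_subset[OF inj]) (auto simp: vertex_cycle_def)
  qed (use v(1) arc in \<open>auto simp: vertex_cycle_def\<close>)
  then show "girth (involutory_cayley_graph S) \<le> enat L"
    by (rule girth_le[OF pair_wf_digraph_involutory_cayley_graph _ v(2)])
qed

context cring
begin

lemma vertex_cycle_step:
  assumes "vertex_cycle (involutory_cayley_graph R) L v" "i < L"
  shows "v i \<in> carrier R" "v (Suc i) \<in> carrier R"
    and "(v (Suc i) \<ominus> v i) \<otimes> (v (Suc i) \<ominus> v i) = \<one>"
proof -
  have *: "v i \<in> carrier R" "v (Suc i) \<in> carrier R" "(v i \<ominus> v (Suc i)) [^] (2::nat) = \<one>"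
    using assms by (auto simp: vertex_cycle_def parcs_involutory_cayley_graph)
  then show "v i \<in> carrier R" "v (Suc i) \<in> carrier R" by auto
  have "(v (Suc i) \<ominus> v i) \<otimes> (v (Suc i) \<ominus> v i) = (v i \<ominus> v (Suc i)) \<otimes> (v i \<ominus> v (Suc i))"
    using *(1,2) by algebra
  then show "(v (Suc i) \<ominus> v i) \<otimes> (v (Suc i) \<ominus> v i) = \<one>"
    using * by (simp add: numeral_2_eq_2)
qed

text \<open>
  Two sides \<open>x\<close>, \<open>y\<close> of a triangle and their sum are involutions, so \<open>1 = (x + y)\<^sup>2 = 2 + 2xy\<close>.
  Hence \<open>2xy = -1\<close>, and its square is both \<open>4x\<^sup>2y\<^sup>2 = 4\<close> and \<open>1\<close>.
\<close>

lemma triangle_imp_three_eq_zero: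
  assumes v: "vertex_cycle (involutory_cayley_graph R) 3 v"
  shows "[(3::nat)] \<cdot> \<one> = \<zero>"
proof -
  define a b c where "a = v 0" and "b = v 1" and "c = v 2"
  have "v 3 = a" using v by (simp add: vertex_cycle_def a_def)
  then have car: "a \<in> carrier R" "b \<in> carrier R" "c \<in> carrier R"
    and 1: "(b \<ominus> a) \<otimes> (b \<ominus> a) = \<one>" and 2: "(c \<ominus> b) \<otimes> (c \<ominus> b) = \<one>"
    and 3: "(a \<ominus> c) \<otimes> (a \<ominus> c) = \<one>"
    using vertex_cycle_step[OF v, of 0] vertex_cycle_step[OF v, of 1]
      vertex_cycle_step[OF v, of 2]
    by (auto simp: a_def b_def c_def numeral_eq_Suc)
  define x y where "x = b \<ominus> a" and "y = c \<ominus> b"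
  have xy: "x \<in> carrier R" "y \<in> carrier R" by (auto simp: x_def y_def car)
  have xx: "x \<otimes> x = \<one>" and yy: "y \<otimes> y = \<one>" using 1 2 by (auto simp: x_def y_def)
  \<comment> \<open>this is \<open>2xy\<close>\<close>
  define t where "t = x \<otimes> y \<oplus> x \<otimes> y"
  have t: "t \<in> carrier R" using xy by (simp add: t_def)
  have "x \<otimes> x \<oplus> y \<otimes> y \<oplus> t = (a \<ominus> c) \<otimes> (a \<ominus> c)"
    unfolding t_def x_def y_def using car by algebra
  then have "\<one> \<oplus> \<one> \<oplus> t = \<one>" using xx yy 3 by simp
  then have "\<ominus> \<one> \<oplus> (\<one> \<oplus> \<one> \<oplus> t) = \<zero>" by (simp add: l_neg)
  moreover have "\<ominus> \<one> \<oplus> (\<one> \<oplus> \<one> \<oplus> t) = \<one> \<oplus> t" using t by algebra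
  ultimately have "t = \<ominus> \<one>" using t by (metis a_comm minus_equality minus_minus one_closed)
  then have "t \<otimes> t = \<one>" by (simp add: l_minus r_minus)
  moreover have "t \<otimes> t = (x \<otimes> x) \<otimes> (y \<otimes> y) \<oplus> (x \<otimes> x) \<otimes> (y \<otimes> y) \<oplus> (x \<otimes> x) \<otimes> (y \<otimes> y) \<oplus> (x \<otimes> x) \<otimes> (y \<otimes> y)"
    unfolding t_def using xy by algebra
  ultimately have "\<one> = \<one> \<oplus> \<one> \<oplus> \<one> \<oplus> \<one>" using xx yy by simp
  then have "\<one> \<oplus> \<one> \<oplus> \<one> = \<zero>"
    by (metis a_assoc a_closed add.r_cancel_one one_closed)
  then show ?thesis by (simp add: numeral_3_eq_3)
qed

text \<open>
  The steps \<open>1\<close>, \<open>u\<close>, \<open>-1\<close>, \<open>-u\<close> go around a parallelogram, which is degenerate only if \<open>u\<close> is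
  \<open>1\<close> or \<open>-1\<close>.
\<close>

lemma vertex_cycle_4_of_involution:
  assumes u: "u \<in> carrier R" "u \<otimes> u = \<one>" and ne: "u \<noteq> \<one>" "u \<noteq> \<ominus> \<one>"
  shows "vertex_cycle (involutory_cayley_graph R) 4 (\<lambda>i. [\<zero>, \<one>, \<one> \<oplus> u, u, \<zero>] ! i)"
proof -
  have "u \<noteq> \<zero>"
    using u ne by force
  moreover have "\<one> \<noteq> \<zero>"
    using u ne by (metis r_null r_one)
  moreover have "\<one> \<oplus> u \<noteq> \<zero>"
    using u ne by (metis a_comm minus_equality one_closed)
  ultimately have dist: "distinct [\<zero>, \<one>, \<one> \<oplus> u, u]"
    using u ne by (auto simp: add.r_cancel_one add.l_cancel_one)
  have "(\<zero> \<ominus> \<one>) \<otimes> (\<zero> \<ominus> \<one>) = \<one>" by algebra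
  moreover have "(\<one> \<ominus> (\<one> \<oplus> u)) \<otimes> (\<one> \<ominus> (\<one> \<oplus> u)) = u \<otimes> u" using u by algebra
  moreover have "(\<one> \<oplus> u \<ominus> u) \<otimes> (\<one> \<oplus> u \<ominus> u) = \<one>" using u by algebra
  moreover have "(u \<ominus> \<zero>) \<otimes> (u \<ominus> \<zero>) = u \<otimes> u" using u by algebra
  ultimately have arcs: "(\<zero>, \<one>) \<in> parcs (involutory_cayley_graph R)"
     "(\<one>, \<one> \<oplus> u) \<in> parcs (involutory_cayley_graph R)"
     "(\<one> \<oplus> u, u) \<in> parcs (involutory_cayley_graph R)"
     "(u, \<zero>) \<in> parcs (involutory_cayley_graph R)"
    using u dist by (auto simp: parcs_involutory_cayley_graph numeral_2_eq_2)
  have set: "{1..4} = {1, 2, 3, 4::nat}" by auto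
  show ?thesis
    unfolding vertex_cycle_def set using dist arcs
    by (auto simp: numeral_eq_Suc less_Suc_eq)
qed

text \<open>
  All steps of the cycle are \<open>1\<close> or \<open>-1\<close>, and a step followed by its negative would return to the
  vertex before the last, which a cycle of length at least \<open>3\<close> does not do. So all steps are
  equal to the first one, and \<open>L\<close> copies of it sum to \<open>0\<close>. If \<open>1 = -1\<close>, every step is its own
  negative and there is no such cycle.
\<close>

lemma vertex_cycle_of_trivial_involutions:
  assumes triv: "\<And>x. x \<in> carrier R \<Longrightarrow> x \<otimes> x = \<one> \<Longrightarrow> x = \<one> \<or> x = \<ominus> \<one>"
    and v: "vertex_cycle (involutory_cayley_graph R) L v" and L: "3 \<le> L"
  shows "\<one> \<noteq> \<ominus> \<one>" and "[L] \<cdot> \<one> = \<zero>"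
proof -
  define s where "s i = v (Suc i) \<ominus> v i" for i
  note step = vertex_cycle_step[OF v]
  have car: "v i \<in> carrier R" "v (Suc i) \<in> carrier R" "s i \<in> carrier R" if "i < L" for i
    using step[OF that] by (auto simp: s_def)
  have s: "s i = \<one> \<or> s i = \<ominus> \<one>" if "i < L" for i
    using triv[OF car(3)[OF that]] step(3)[OF that] by (simp add: s_def)
  have v_Suc: "v (Suc i) = v i \<oplus> s i" if "i < L" for i
    unfolding s_def using car[OF that] by algebra
  have no_return: "s (Suc i) \<noteq> \<ominus> s i" if "Suc i < L" for i
  proof
    assume "s (Suc i) = \<ominus> s i"
    then have "v (Suc (Suc i)) = v i \<oplus> s i \<oplus> \<ominus> s i"
      using v_Suc[of i] v_Suc[of "Suc i"] that by simp
    also have "\<dots> = v i" using car(1,3)[of i] that by (simp add: a_assoc r_neg)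
    finally have eq: "v (Suc (Suc i)) = v i" .
    have inj: "inj_on v {1..L}" and "v 0 = v L" using v by (auto simp: vertex_cycle_def)
    show False
    proof (cases i)
      \<comment> \<open>Index \<open>0\<close> lies outside the range of injectivity; it is replaced by \<open>L\<close>.\<close>
      case 0
      then have "v 2 = v L" using eq \<open>v 0 = v L\<close> by (simp add: numeral_2_eq_2)
      then show False using inj_onD[OF inj, of 2 L] L by auto
    next
      case (Suc j)
      then show False using inj_onD[OF inj eq] that by auto
    qed
  qed
  show "\<one> \<noteq> \<ominus> \<one>"
    using no_return[of 0] s[of 0] s[of 1] L by auto
  have const: "s i = s 0" if "i < L" for i
    using that
  proof (induction i)
    case (Suc i)
    then have "s i = s 0" by simp
    then show ?case using s[of i] s[of "Suc i"] no_return[of i] Suc.prems by auto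
  qed simp
  have s0: "s 0 \<in> carrier R" "v 0 \<in> carrier R" using car L by auto
  have "v i = v 0 \<oplus> [i] \<cdot> s 0" if "i \<le> L" for i
    using that
  proof (induction i)
    case 0
    then show ?case using s0 by simp
  next
    case (Suc i)
    then show ?case using v_Suc[of i] const[of i] s0 by (simp add: a_assoc)
  qed
  from this[of L] have "v 0 \<oplus> [L] \<cdot> s 0 = v 0"
    using v by (simp add: vertex_cycle_def)
  then have L0: "[L] \<cdot> s 0 = \<zero>" using s0 by simp
  show "[L] \<cdot> \<one> = \<zero>"
    using s[of 0]
  proof
    assume "s 0 = \<ominus> \<one>"
    then have "\<ominus> ([L] \<cdot> \<one>) = \<zero>" using L0 by (simp add: add.nat_pow_inv a_inv_def[symmetric])
    then show ?thesis by (metis add.nat_pow_closed minus_minus minus_zero one_closed)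
  qed (use L0 L in auto)
qed

end

section \<open>Involutions modulo \<open>n\<close>\<close>

lemma residue_ring_cycle:
  assumes "n \<ge> 3"
  shows "vertex_cycle (involutory_cayley_graph (residue_ring (int n))) n (\<lambda>i. int i mod int n)"
proof -
  interpret residues "int n" "residue_ring (int n)"
    by unfold_locales (use assms in auto)
  let ?R = "residue_ring (int n)"
  have "inj_on (\<lambda>i. int i mod int n) {1..n}"
  proof (rule inj_onI)
    fix i j assume ij: "i \<in> {1..n}" "j \<in> {1..n}" "int i mod int n = int j mod int n"
    then have "i mod n = j mod n"
      by (metis of_nat_eq_iff zmod_int)
    with ij show "i = j" by (cases "i = n"; cases "j = n") auto
  qed
  moreover have "(int i mod int n, int (Suc i) mod int n) \<in> parcs (involutory_cayley_graph ?R)" for i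
  proof -
    have "(int i mod int n) \<ominus>\<^bsub>?R\<^esub> (int (Suc i) mod int n) = (-1) mod int n"
      by (simp add: minus_eq neg_cong add_cong)
    moreover have "int i mod int n \<noteq> int (Suc i) mod int n"
    proof
      assume "int i mod int n = int (Suc i) mod int n"
      then have "int n dvd int (Suc i) - int i" by (metis mod_eq_dvd_iff)
      then show False using assms by auto
    qed
    ultimately show ?thesis
      by (simp add: parcs_involutory_cayley_graph pow_cong one_cong)
  qed
  moreover have "int 0 mod int n = int n mod int n" by simp
  ultimately show ?thesis unfolding vertex_cycle_def by blast
qed

text \<open>
  By the Chinese remainder theorem some \<open>u\<close> is \<open>1\<close> modulo one factor and \<open>-1\<close> modulo the other;
  as both factors exceed \<open>2\<close>, these two signs differ modulo each of them.
\<close>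

lemma nontrivial_involution_mod_coprime_product:
  fixes a b :: int
  assumes "coprime a b" "a > 2" "b > 2"
  shows "\<exists>u. [u\<^sup>2 = 1] (mod a * b) \<and> \<not> [u = 1] (mod a * b) \<and> \<not> [u = -1] (mod a * b)"
proof -
  obtain u where u: "[u = 1] (mod a)" "[u = -1] (mod b)"
    using binary_chinese_remainder_int[OF assms(1)] by blast
  have "[u\<^sup>2 = 1] (mod a)" "[u\<^sup>2 = 1] (mod b)"
    using cong_pow[OF u(1), of 2] cong_pow[OF u(2), of 2] by auto
  then have "[u\<^sup>2 = 1] (mod a * b)"
    using assms(1) by (simp add: coprime_cong_mult)
  moreover have "\<not> [u = 1] (mod a * b)"
  proof
    assume "[u = 1] (mod a * b)"
    then have "[u = 1] (mod b)" by (metis cong_modulus_mult mult.commute)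
    then have "[1 = -1] (mod b)" using u(2) cong_sym cong_trans by blast
    then have "b dvd 2" by (simp add: cong_iff_dvd_diff)
    then show False using assms zdvd_imp_le by force
  qed
  moreover have "\<not> [u = -1] (mod a * b)"
  proof
    assume "[u = -1] (mod a * b)"
    then have "[u = -1] (mod a)" by (metis cong_modulus_mult)
    then have "[1 = -1] (mod a)" using u(1) cong_sym cong_trans by blast
    then have "a dvd 2" by (simp add: cong_iff_dvd_diff)
    then show False using assms zdvd_imp_le by force
  qed
  ultimately show ?thesis by blast
qed

lemma nontrivial_involution_mod_power_of_2:
  assumes "j \<ge> 3"
  shows "\<exists>u::int. [u\<^sup>2 = 1] (mod 2 ^ j) \<and> \<not> [u = 1] (mod 2 ^ j) \<and> \<not> [u = -1] (mod 2 ^ j)"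
proof -
  obtain i where j: "j = i + 3" using assms by (metis le_add_diff_inverse2)
  define h :: int where "h = 2 ^ i"
  have h: "h > 0" "2 ^ j = 8 * h" by (auto simp: h_def j power_add)
  \<comment> \<open>so \<open>u = 1 + 2 ^ (j - 1)\<close>\<close>
  define u where "u = 1 + 4 * h"
  have "u\<^sup>2 - 1 = 8 * h * (1 + 2 * h)" by (simp add: u_def power2_eq_square algebra_simps)
  then have "[u\<^sup>2 = 1] (mod 8 * h)" by (simp add: cong_iff_dvd_diff)
  moreover have "\<not> [u = 1] (mod 8 * h)"
    using h by (auto simp: cong_iff_dvd_diff u_def dest!: zdvd_imp_le)
  moreover have "\<not> [u = -1] (mod 8 * h)"
  proof
    assume "[u = -1] (mod 8 * h)"
    then have "8 * h dvd 4 * h + 2" by (simp add: cong_iff_dvd_diff u_def algebra_simps)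
    then have "8 * h \<le> 4 * h + 2" using h by (intro zdvd_imp_le) auto
    then show False using h by linarith
  qed
  ultimately show ?thesis using h by auto
qed

text \<open>
  If an odd prime \<open>p\<close> divides \<open>n\<close>, split off its full power: the cofactor is coprime to it, and
  it exceeds \<open>2\<close> because \<open>n\<close> is neither \<open>p\<^sup>k\<close> nor \<open>2p\<^sup>k\<close>. Otherwise \<open>n\<close> is a power of \<open>2\<close> and at
  least \<open>8\<close>.
\<close>

lemma nontrivial_involution_exists:
  fixes n :: nat
  assumes n: "n \<ge> 2" "n \<noteq> 2" "n \<noteq> 4"
    and not_cyclic: "\<nexists>p k :: nat. prime p \<and> odd p \<and> k > 0 \<and> (n = p ^ k \<or> n = 2 * p ^ k)"
  shows "\<exists>u::int. [u\<^sup>2 = 1] (mod int n) \<and> \<not> [u = 1] (mod int n) \<and> \<not> [u = -1] (mod int n)"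
proof (cases "\<exists>p. prime p \<and> odd p \<and> p dvd n")
  case True
  then obtain p where p: "prime p" "odd p" "p dvd n" by blast
  define k where "k = multiplicity p n"
  obtain b where b: "n = p ^ k * b" "\<not> p dvd b"
    using multiplicity_decompose'[of n p] p n unfolding k_def
    by (metis not_prime_unit not_numeral_le_zero)
  have k: "k > 0" using p n b by (metis gr0I mult_1 power_0)
  have "p \<ge> 3" using p prime_ge_2_nat[of p] by (cases "p = 2") auto
  moreover have "p \<le> p ^ k" using k p prime_gt_0_nat by (intro self_le_power) (auto simp: Suc_le_eq)
  ultimately have "p ^ k > 2" by linarith
  moreover have "b > 2"
  proof -
    have "b \<noteq> 0" using b n by (metis dvd_0_right)
    moreover have "b \<noteq> 1" using b not_cyclic p k by (metis mult.right_neutral)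
    moreover have "b \<noteq> 2" using b not_cyclic p k by (metis mult.commute)
    ultimately show ?thesis by linarith
  qed
  moreover have "coprime (p ^ k) b" using p b prime_imp_coprime by auto
  ultimately show ?thesis
    using nontrivial_involution_mod_coprime_product[of "int (p ^ k)" "int b"] b
    by (simp add: coprime_int_iff flip: of_nat_mult of_nat_power)
next
  case False
  obtain j m where jm: "n = 2 ^ j * m" "\<not> 2 dvd m"
    using multiplicity_decompose'[of n 2] n by (metis not_numeral_le_zero odd_one)
  have "m = 1"
  proof (rule ccontr)
    assume "m \<noteq> 1"
    then obtain q where "prime q" "q dvd m" using prime_factor_nat by blast
    then show False using False jm by (metis dvd_mult dvd_trans)
  qed
  then have nj: "n = 2 ^ j" using jm by simp
  have "j \<ge> 3"
  proof (rule ccontr)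
    assume "\<not> j \<ge> 3"
    then have "j = 0 \<or> j = 1 \<or> j = 2" by linarith
    then show False using n nj by auto
  qed
  then show ?thesis
    using nontrivial_involution_mod_power_of_2[of j] nj by simp
qed

section \<open>Involutions of the polynomial ring modulo \<open>n\<close>\<close>

text \<open>
  The constant polynomial \<open>p\<close> is a prime element of \<open>\<int>[x]\<close>. It cannot divide both \<open>F - 1\<close> and
  \<open>F + 1\<close>, since these differ by \<open>2\<close>, so one factor absorbs all of \<open>p ^ k\<close>.
\<close>

lemma involution_int_poly_mod_prime_power:
  fixes F :: "int poly"
  assumes p: "prime p" "odd p" and dvd: "[:int (p ^ k):] dvd (F - 1) * (F + 1)"
  shows "[:int (p ^ k):] dvd F - 1 \<or> [:int (p ^ k):] dvd F + 1"
proof -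
  have prime: "prime_elem [:int p:]"
    using p by (simp add: prime_elem_const_poly_iff)
  have pow: "[:int (p ^ k):] = [:int p:] ^ k" by (simp add: poly_const_pow)
  have not_both: "\<not> ([:int p:] dvd F - 1 \<and> [:int p:] dvd F + 1)"
  proof
    assume "[:int p:] dvd F - 1 \<and> [:int p:] dvd F + 1"
    then have "[:int p:] dvd (F + 1) - (F - 1)" by (blast intro: dvd_diff)
    also have "(F + 1) - (F - 1) = [:2:]" by (simp add: numeral_poly)
    finally have "int p dvd int 2" by simp
    then have "p dvd 2" by presburger
    then show False using p by (metis dvd_refl primes_dvd_imp_eq two_is_prime_nat)
  qed
  show ?thesis
  proof (cases "k = 0")
    case False
    from not_both consider "\<not> [:int p:] dvd F - 1" | "\<not> [:int p:] dvd F + 1" by blast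
    then show ?thesis
    proof cases
      case 1
      then show ?thesis
        using prime_power_dvd_multD[OF prime, of k "F - 1" "F + 1"] dvd False unfolding pow by blast
    next
      case 2
      then show ?thesis
        using prime_power_dvd_multD[OF prime, of k "F + 1" "F - 1"] dvd False
        unfolding pow mult.commute[of "F - 1"] by blast
    qed
  qed (simp add: one_pCons[symmetric])
qed

text \<open>
  Modulo \<open>2\<close> both factors agree, so \<open>2\<close> divides both. This is what lets the case \<open>2p\<^sup>k\<close> follow the
  sign that is found modulo \<open>p\<^sup>k\<close>.
\<close>

lemma involution_int_poly_mod_2:
  fixes F :: "int poly"
  assumes "[:2:] dvd (F - 1) * (F + 1)"
  shows "[:2:] dvd F - 1" and "[:2:] dvd F + 1"
proof -
  have "prime_elem [:2::int:]"
    by (simp add: prime_elem_const_poly_iff)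
  then have "[:2:] dvd F - 1 \<or> [:2:] dvd F + 1"
    using assms by (rule prime_elem_dvd_multD)
  moreover have "F + 1 = (F - 1) + [:2:] * 1" "F - 1 = (F + 1) - [:2:] * 1"
    by (simp_all add: numeral_poly[symmetric])
  ultimately show "[:2:] dvd F - 1" and "[:2:] dvd F + 1"
    by (metis dvd_add dvd_diff dvd_triv_left)+
qed

lemma involution_int_poly_mod:
  fixes F :: "int poly"
  assumes n: "n = 2 \<or> (\<exists>p k :: nat. prime p \<and> odd p \<and> k > 0 \<and> (n = p ^ k \<or> n = 2 * p ^ k))"
    and dvd: "[:int n:] dvd (F - 1) * (F + 1)"
  shows "[:int n:] dvd F - 1 \<or> [:int n:] dvd F + 1"
  using n
proof (elim disjE exE conjE)
  fix p k :: nat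
  assume p: "prime p" "odd p" and n: "n = 2 * p ^ k"
  let ?q = "int (p ^ k)"
  have split: "[:int n:] = [:2:] * [:?q:]" using n by simp
  have "[:2:] dvd (F - 1) * (F + 1)" "[:?q:] dvd (F - 1) * (F + 1)"
    using dvd unfolding split by (blast intro: dvd_mult_left dvd_mult_right)+
  note 2 = involution_int_poly_mod_2[OF this(1)]
    and q = involution_int_poly_mod_prime_power[OF p this(2)]
  have "coprime 2 ?q" using p by simp
  then have "[:int n:] dvd G" if "[:2:] dvd G" "[:?q:] dvd G" for G :: "int poly"
    using that n unfolding const_poly_dvd_iff by (auto intro: divides_mult)
  then show ?thesis using 2 q by blast
next
  assume "n = 2"
  then show ?thesis using involution_int_poly_mod_2(1)[of F] dvd by simp
next
  fix p k :: nat
  assume "prime p" "odd p" and n: "n = p ^ k"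
  then show ?thesis
    using involution_int_poly_mod_prime_power[of p k F] dvd unfolding n by blast
qed

text \<open>
  The coefficients of a polynomial over \<open>\<int>\<^sub>n\<close> are integers in \<open>{0..n - 1}\<close>, so the coefficient
  sequence is itself that of an integer polynomial \<open>F\<close>. Products in the two rings agree
  modulo \<open>n\<close>, so \<open>f\<^sup>2 = 1\<close> says that \<open>n\<close> divides \<open>F\<^sup>2 - 1\<close> in \<open>\<int>[x]\<close>.
\<close>

lemma UP_residue_ring_trivial_involutions:
  fixes n :: nat
  defines "P \<equiv> UP (residue_ring (int n))"
  assumes n: "n \<ge> 2"
    and triv: "\<And>F :: int poly. [:int n:] dvd (F - 1) * (F + 1) \<Longrightarrow>
      [:int n:] dvd F - 1 \<or> [:int n:] dvd F + 1"
    and f: "f \<in> carrier P" "f \<otimes>\<^bsub>P\<^esub> f = \<one>\<^bsub>P\<^esub>"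
  shows "f = \<one>\<^bsub>P\<^esub> \<or> f = \<ominus>\<^bsub>P\<^esub> \<one>\<^bsub>P\<^esub>"
proof -
  let ?R = "residue_ring (int n)"
  interpret R: residues "int n" ?R
    by unfold_locales (use n in auto)
  interpret UP_cring ?R P
    unfolding UP_cring_def UP_def P_def by (simp add: R.cring)
  have coeff_f: "up_ring.coeff P f = f"
    using f(1) by (auto simp: P_def UP_def)
  from f(1) obtain d where "bound \<zero>\<^bsub>?R\<^esub> d f"
    by (auto simp: P_def UP_def up_def)
  then have "f i = 0" if "i > d" for i
    using that by (auto simp: R.res_zero_eq)
  define F where "F = Abs_poly f"
  have F: "poly.coeff F = f"
    unfolding F_def by (rule coeff_Abs_poly) fact
  have red: "f i mod int n = f i" for i
    using coeff_closed[OF f(1), of i] n unfolding coeff_f by (simp add: R.res_carrier_eq)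
  have "[:int n:] dvd F * F - 1"
    unfolding const_poly_dvd_iff
  proof
    fix m
    have "(\<Sum>i\<le>m. f i * f (m - i)) mod int n =
        (\<Oplus>\<^bsub>?R\<^esub>i\<in>{..m}. (f i * f (m - i)) mod int n)"
      by (simp add: R.sum_cong)
    also have "\<dots> = up_ring.coeff P (f \<otimes>\<^bsub>P\<^esub> f) m"
      using f(1) by (simp add: coeff_f R.res_mult_eq)
    also have "\<dots> = (if m = 0 then 1 else 0)"
      unfolding f(2) by (simp add: R.res_one_eq R.res_zero_eq)
    finally show "int n dvd poly.coeff (F * F - 1) m"
      using n by (auto simp: Polynomial.coeff_mult F mod_eq_dvd_iff[symmetric])
  qed
  then have "[:int n:] dvd (F - 1) * (F + 1)"
    by (simp add: algebra_simps)
  from triv[OF this] show ?thesis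
  proof
    assume "[:int n:] dvd F - 1"
    then have "[f i = (if i = 0 then 1 else 0)] (mod int n)" for i
      unfolding const_poly_dvd_iff by (auto simp: F cong_iff_dvd_diff dest: spec[of _ i])
    then have "f i = (if i = 0 then 1 else 0)" for i
      using red n unfolding cong_def by auto
    then have "f = \<one>\<^bsub>P\<^esub>"
      by (auto simp: P_def UP_def R.res_one_eq R.res_zero_eq)
    then show ?thesis ..
  next
    assume *: "[:int n:] dvd F + 1"
    have "f \<oplus>\<^bsub>P\<^esub> \<one>\<^bsub>P\<^esub> = \<zero>\<^bsub>P\<^esub>"
    proof (rule up_eqI)
      fix i
      show "up_ring.coeff P (f \<oplus>\<^bsub>P\<^esub> \<one>\<^bsub>P\<^esub>) i = up_ring.coeff P \<zero>\<^bsub>P\<^esub> i"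
        using *[unfolded const_poly_dvd_iff, THEN spec, of i] f(1) red[of i]
        by (auto simp: F coeff_f R.res_add_eq R.res_one_eq R.res_zero_eq)
    qed (use f(1) in auto)
    then have "f = \<ominus>\<^bsub>P\<^esub> \<one>\<^bsub>P\<^esub>"
      using f(1) by (metis P.minus_equality UP_one_closed)
    then show ?thesis ..
  qed
qed

lemma UP_residue_ring_char_dvd:
  fixes n :: nat
  defines "P \<equiv> UP (residue_ring (int n))"
  assumes n: "n \<ge> 2" and "[L] \<cdot>\<^bsub>P\<^esub> \<one>\<^bsub>P\<^esub> = \<zero>\<^bsub>P\<^esub>"
  shows "n dvd L"
proof -
  let ?R = "residue_ring (int n)"
  interpret R: residues "int n" ?R
    by unfold_locales (use n in auto)
  interpret UP_cring ?R P
    unfolding UP_cring_def UP_def P_def by (simp add: R.cring)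
  have "up_ring.coeff P ([L] \<cdot>\<^bsub>P\<^esub> \<one>\<^bsub>P\<^esub>) 0 = int L mod int n" for L :: nat
    by (induction L) (auto simp: R.res_zero_eq R.res_one_eq R.res_add_eq mod_simps add_ac)
  from this[of L] have "int n dvd int L"
    unfolding assms(3) by (simp add: R.res_zero_eq dvd_eq_mod_eq_0)
  then show ?thesis by simp
qed

section \<open>The girth of the graph over \<open>\<int>\<^sub>n\<close> and over its polynomial ring\<close>

lemma girth_UP_le:
  assumes "cring R"
  shows "girth (involutory_cayley_graph (UP R)) \<le> girth (involutory_cayley_graph R)"
proof -
  interpret UP_cring R "UP R"
    by (simp add: UP_cring_def assms)
  have "(\<lambda>a. up_ring.monom (UP R) a 0) \<in> ring_hom R (UP R)"
    by (intro ring_hom_memI) (simp_all add: monom_mult_is_smult monom_mult_smult)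
  moreover have "inj_on (\<lambda>a. up_ring.monom (UP R) a 0) (carrier R)"
    by (rule monom_inj)
  ultimately show ?thesis
    by (rule girth_le_of_embedding[OF assms P.cring_axioms])
qed

theorem theorem3p8:
  fixes n :: nat
  assumes "n \<ge> 2"
  shows "girth (involutory_cayley_graph (UP (residue_ring (int n)))) =
           girth (involutory_cayley_graph (residue_ring (int n))) \<and>
         girth (involutory_cayley_graph (residue_ring (int n))) =
           (if n = 2 then \<infinity>
            else if \<exists>p k :: nat. prime p \<and> odd p \<and> k > 0 \<and> (n = p ^ k \<or> n = 2 * p ^ k)
            then enat n
            else 4)"
proof -
  let ?R = "residue_ring (int n)"
  let ?P = "UP ?R"
  define cyclic where "cyclic \<longleftrightarrow> (\<exists>p k :: nat. prime p \<and> odd p \<and> k > 0 \<and> (n = p ^ k \<or> n = 2 * p ^ k))"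
  let ?g = "if n = 2 then \<infinity> else if cyclic then enat n else 4"
  interpret R: residues "int n" ?R
    by unfold_locales (use assms in auto)
  interpret P: UP_cring ?R ?P
    by (simp add: UP_cring_def R.cring)
  have "girth (involutory_cayley_graph ?P) \<le> girth (involutory_cayley_graph ?R)"
    by (rule girth_UP_le[OF R.cring])
  moreover have "girth (involutory_cayley_graph ?R) \<le> ?g"
  proof -
    have "n = 2 \<or> n \<ge> 3" using assms by linarith
    then consider "n = 2" | "n \<ge> 3" "cyclic \<or> n = 4" | "n \<ge> 3" "n \<noteq> 4" "\<not> cyclic"
      by blast
    then show ?thesis
    proof cases
      case 2
      have "girth (involutory_cayley_graph ?R) \<le> enat n"
        by (rule girth_le[OF pair_wf_digraph_involutory_cayley_graph residue_ring_cycle]) fact+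
      moreover have "enat n \<le> ?g"
        using 2 by (auto simp: numeral_eq_enat)
      ultimately show ?thesis by (rule order_trans)
    next
      case 3
      obtain u :: int where u: "[u\<^sup>2 = 1] (mod int n)" "\<not> [u = 1] (mod int n)"
          "\<not> [u = -1] (mod int n)"
        using nontrivial_involution_exists[of n] 3 unfolding cyclic_def by auto
      have "(u mod int n) \<otimes>\<^bsub>?R\<^esub> (u mod int n) = \<one>\<^bsub>?R\<^esub>"
        "u mod int n \<noteq> \<one>\<^bsub>?R\<^esub>" "u mod int n \<noteq> \<ominus>\<^bsub>?R\<^esub> \<one>\<^bsub>?R\<^esub>"
        using u by (simp_all add: R.one_cong R.mult_cong R.neg_cong cong_def power2_eq_square)
      from R.vertex_cycle_4_of_involution[OF R.mod_in_carrier this]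
      have "girth (involutory_cayley_graph ?R) \<le> enat 4"
        by (rule girth_le[OF pair_wf_digraph_involutory_cayley_graph]) simp
      then show ?thesis using 3 by (simp add: numeral_eq_enat)
    qed simp
  qed
  moreover have "?g \<le> girth (involutory_cayley_graph ?P)"
  proof (rule le_girth[OF pair_wf_digraph_involutory_cayley_graph])
    fix L v assume v: "vertex_cycle (involutory_cayley_graph ?P) L v" "3 \<le> L"
    show "?g \<le> enat L"
    proof (cases "n = 2 \<or> cyclic")
      case True
      have triv: "f = \<one>\<^bsub>?P\<^esub> \<or> f = \<ominus>\<^bsub>?P\<^esub> \<one>\<^bsub>?P\<^esub>"
        if "f \<in> carrier ?P" "f \<otimes>\<^bsub>?P\<^esub> f = \<one>\<^bsub>?P\<^esub>" for f
        using UP_residue_ring_trivial_involutions[OF assms involution_int_poly_mod[OF True[unfolded cyclic_def]]] that by blast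
      note cyc = P.P.vertex_cycle_of_trivial_involutions[OF triv v]
      have "n \<noteq> 2"
      proof
        assume "n = 2"
        then have two_eq: "2 mod int n = 0" by simp
        have "\<one>\<^bsub>?P\<^esub> \<oplus>\<^bsub>?P\<^esub> \<one>\<^bsub>?P\<^esub> = \<zero>\<^bsub>?P\<^esub>"
          by (rule P.up_eqI) (simp_all add: R.res_add_eq R.res_one_eq R.res_zero_eq two_eq)
        then show False
          using cyc(1) by (metis P.P.minus_equality P.UP_one_closed)
      qed
      moreover have "n \<le> L"
        using UP_residue_ring_char_dvd[OF assms cyc(2)] v(2) by (intro dvd_imp_le) auto
      ultimately show ?thesis using True by simp
    next
      case False
      have "L \<noteq> 3"
      proof
        assume "L = 3"
        then have "n dvd 3"
          using UP_residue_ring_char_dvd[OF assms P.P.triangle_imp_three_eq_zero] v(1) by blast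
        then have "n = 3 ^ 1"
          using assms prime_nat_iff[of 3] by auto
        then have cyclic
          unfolding cyclic_def by (intro exI[of _ 3] exI[of _ 1]) simp
        then show False using False by simp
      qed
      then show ?thesis using False v(2) by (simp add: numeral_eq_enat)
    qed
  qed
  moreover have "x \<le> y \<Longrightarrow> y \<le> z \<Longrightarrow> z \<le> x \<Longrightarrow> x = y \<and> y = z" for x y z :: enat
    by auto
  ultimately have "girth (involutory_cayley_graph ?P) = girth (involutory_cayley_graph ?R) \<and>
      girth (involutory_cayley_graph ?R) = ?g"
    by blast
  then show ?thesis unfolding cyclic_def .
qed

end
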